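(* Let $\mathcal{H}$ be a separable Hilbert space, $K\in B(\mathcal{H})$ an operator with closed range, and $W=\{(W_i,\omega_i)\}_{i\in I}$ a minimal $K$-fusion frame for $\mathcal{H}$ with the canonical $K$-dual $\widetilde{W}=\{(K^*S_W^{-1}\pi_{S_W(R(K))}W_i,\omega_i)\}_{i\in I}$ (so that $\widetilde W$ is a Bessel fusion sequence). Assume also that $\overline{\mathrm{span}}\{W_i\}_{i\in I}\cap R(K)^{\perp}=\{0\}$. Then a Bessel fusion sequence $V=\{(V_i,\omega_i)\}_{i\in I}$ is a $K$-dual of $W$ if and only if $K^*S_W^{-1}\pi_{S_W(R(K))}W_i\subseteq V_i$ for all $i\in I$.
   Context: $I$ is a countable index set; $R(T)$ is the range of $T$; $\pi_V$ is the orthogonal projection of $\mathcal{H}$ onto a closed subspace $V$. A family $\{(W_i,\omega_i)\}_{i\in I}$ of closed subspaces with weights $\omega_i>0$ is a Bessel fusion sequence if there is $B<\infty$ with $\sum_i\omega_i^2\|\pi_{W_i}f\|^2\le B\|f\|^2$ for all $f\in\mathcal{H}$, and a $K$-fusion frame if moreover there is $A>0$ with $A\|K^*f\|^2\le\sum_i\omega_i^2\|\pi_{W_i}f\|^2$ for all $f$. A $K$-fusion frame is minimal if $W_i\cap\overline{\mathrm{span}}_{j\in I,\,j\ne i}W_j=\{0\}$ for every $i\in I$. The frame operator is $S_Wf=\sum_i\omega_i^2\pi_{W_i}f$. When $K$ has closed range and $W$ is a $K$-fusion frame, $S_W(R(K))$ is closed and the restriction $S_W:R(K)\to S_W(R(K))$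 is invertible with bounded inverse; $S_W^{-1}:S_W(R(K))\to R(K)$ denotes this inverse and $(S_W^{-1})^*:R(K)\to S_W(R(K))$ its adjoint. A Bessel fusion sequence $V=\{(V_i,\upsilon_i)\}_{i\in I}$ is called a $K$-dual of $W$ if $$Kf=\sum_{i\in I}\omega_i\upsilon_i\,\pi_{R(K)}\pi_{W_i}(S_W^{-1})^*K\pi_{V_i}f\qquad(f\in\mathcal{H}).$$ If $\{(K^*S_W^{-1}\pi_{S_W(R(K))}W_i,\omega_i)\}_{i\in I}$ is a Bessel fusion sequence, it is called the canonical $K$-dual of $W$. *)

theory Defs
  imports "HOL-Analysis.Analysis" "Jordan_Normal_Form.Conjugate"
begin

text \<open>
  The scalar field is real or complex: up to isomorphism these are the only real normed fields,
  and \<open>mult_conjugate\<close> forces \<open>conjugate\<close> to be the usual conjugation.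
\<close>

class rc_field = real_normed_field + conjugatable_field +
  assumes mult_conjugate: "z * conjugate z = (norm z)\<^sup>2 *\<^sub>R 1"

instance real :: rc_field
  by standard (simp add: power2_eq_square)

instance complex :: rc_field
  by standard (simp add: scaleR_conv_of_real complex_norm_square del: of_real_power)

text \<open>
  A Hilbert space over \<open>'k\<close> with inner product \<open>ip\<close>, linear in the first argument.
  The sort \<open>real_inner\<close> is no restriction: the real part of \<open>ip\<close> is a real inner product
  inducing the same norm, and by polarization \<open>ip_self\<close> makes it the inner product of the class.
\<close>

locale hilbert_space = vector_space smul
  for smul :: "'k::rc_field \<Rightarrow> 'a::{real_inner,complete_space} \<Rightarrow> 'a" +
  fixes ip :: "'a \<Rightarrow> 'a \<Rightarrow> 'k"
  assumes smul_of_real: "smul (of_real r) x = r *\<^sub>R x"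
    and ip_add_left: "ip (x + y) z = ip x z + ip y z"
    and ip_smul_left: "ip (smul c x) y = c * ip x y"
    and ip_commute: "ip x y = conjugate (ip y x)"
    and ip_self: "ip x x = of_real ((norm x)\<^sup>2)"

lemma hilbert_space_real:
  "hilbert_space scaleR (inner :: 'a::{real_inner,complete_space} \<Rightarrow> 'a \<Rightarrow> real)"
  by standard (simp_all add: algebra_simps inner_commute power2_norm_eq_inner)

lemma hilbert_space_complex:
  "hilbert_space (*) (\<lambda>x y. x * cnj y :: complex)"
  by standard (simp_all add: algebra_simps scaleR_conv_of_real complex_norm_square del: of_real_power)

definition closed_subspace :: "('k::rc_field \<Rightarrow> 'a::real_normed_vector \<Rightarrow> 'a) \<Rightarrow> 'a set \<Rightarrow> bool"
  where "closed_subspace smul V \<longleftrightarrow> module.subspace smul V \<and> closed V"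

definition closed_span :: "('k::rc_field \<Rightarrow> 'a::real_normed_vector \<Rightarrow> 'a) \<Rightarrow> 'a set \<Rightarrow> 'a set"
  where "closed_span smul X = closure (module.span smul X)"

definition bounded_operator ::
    "('k::rc_field \<Rightarrow> 'a::real_normed_vector \<Rightarrow> 'a) \<Rightarrow> ('a \<Rightarrow> 'a) \<Rightarrow> bool"
  where "bounded_operator smul T \<longleftrightarrow>
    Vector_Spaces.linear smul smul T \<and> (\<exists>C. \<forall>x. norm (T x) \<le> C * norm x)"

definition orth_compl :: "('a \<Rightarrow> 'a \<Rightarrow> 'k::rc_field) \<Rightarrow> 'a set \<Rightarrow> 'a set"
  where "orth_compl ip X = {x. \<forall>y\<in>X. ip x y = 0}"

definition proj :: "('a \<Rightarrow> 'a \<Rightarrow> 'k::rc_field) \<Rightarrow> 'a::real_normed_vector set \<Rightarrow> 'a \<Rightarrow> 'a"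
  where "proj ip V f = (THE v. v \<in> V \<and> f - v \<in> orth_compl ip V)"

text \<open>
  The adjoint of an operator \<open>T\<close> with domain the closed subspace \<open>U\<close>. It takes values in \<open>U\<close>
  and is meant to be applied to elements of the codomain of \<open>T\<close>, itself a closed subspace
  which the defining equation does not mention.
\<close>

definition adjoint_on ::
    "('a \<Rightarrow> 'a \<Rightarrow> 'k::rc_field) \<Rightarrow> 'a set \<Rightarrow> ('a \<Rightarrow> 'a) \<Rightarrow> 'a \<Rightarrow> 'a"
  where "adjoint_on ip U T y = (THE z. z \<in> U \<and> (\<forall>x\<in>U. ip (T x) y = ip x z))"

text \<open>
  Sums over the index set are unconditional. A series of nonnegative reals being bounded
  includes its summability, since \<open>infsum\<close> is 0 on divergent series.
\<close>

definition bessel_fusion_sequence ::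
    "('k::rc_field \<Rightarrow> 'a::real_normed_vector \<Rightarrow> 'a) \<Rightarrow> ('a \<Rightarrow> 'a \<Rightarrow> 'k) \<Rightarrow>
      'i set \<Rightarrow> ('i \<Rightarrow> 'a set) \<Rightarrow> ('i \<Rightarrow> real) \<Rightarrow> bool"
  where "bessel_fusion_sequence smul ip I W \<omega> \<longleftrightarrow>
    (\<forall>i\<in>I. closed_subspace smul (W i) \<and> \<omega> i > 0) \<and>
    (\<exists>B. \<forall>f. (\<lambda>i. (\<omega> i)\<^sup>2 * (norm (proj ip (W i) f))\<^sup>2) summable_on I \<and>
       (\<Sum>\<^sub>\<infinity>i\<in>I. (\<omega> i)\<^sup>2 * (norm (proj ip (W i) f))\<^sup>2) \<le> B * (norm f)\<^sup>2)"

definition K_fusion_frame ::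
    "('k::rc_field \<Rightarrow> 'a::real_normed_vector \<Rightarrow> 'a) \<Rightarrow> ('a \<Rightarrow> 'a \<Rightarrow> 'k) \<Rightarrow> ('a \<Rightarrow> 'a) \<Rightarrow>
      'i set \<Rightarrow> ('i \<Rightarrow> 'a set) \<Rightarrow> ('i \<Rightarrow> real) \<Rightarrow> bool"
  where "K_fusion_frame smul ip K I W \<omega> \<longleftrightarrow>
    bessel_fusion_sequence smul ip I W \<omega> \<and>
    (\<exists>A>0. \<forall>f. A * (norm (adjoint_on ip UNIV K f))\<^sup>2
       \<le> (\<Sum>\<^sub>\<infinity>i\<in>I. (\<omega> i)\<^sup>2 * (norm (proj ip (W i) f))\<^sup>2))"

definition minimal_family ::
    "('k::rc_field \<Rightarrow> 'a::real_normed_vector \<Rightarrow> 'a) \<Rightarrow> 'i set \<Rightarrow> ('i \<Rightarrow> 'a set) \<Rightarrow> bool"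
  where "minimal_family smul I W \<longleftrightarrow>
    (\<forall>i\<in>I. W i \<inter> closed_span smul (\<Union>j\<in>I - {i}. W j) = {0})"

definition frame_operator ::
    "('a \<Rightarrow> 'a \<Rightarrow> 'k::rc_field) \<Rightarrow> 'i set \<Rightarrow> ('i \<Rightarrow> 'a::real_normed_vector set) \<Rightarrow>
      ('i \<Rightarrow> real) \<Rightarrow> 'a \<Rightarrow> 'a"
  where "frame_operator ip I W \<omega> f = (\<Sum>\<^sub>\<infinity>i\<in>I. (\<omega> i)\<^sup>2 *\<^sub>R proj ip (W i) f)"

definition SRK ::
    "('a \<Rightarrow> 'a \<Rightarrow> 'k::rc_field) \<Rightarrow> ('a \<Rightarrow> 'a) \<Rightarrow> 'i set \<Rightarrow> ('i \<Rightarrow> 'a::real_normed_vector set) \<Rightarrow>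
      ('i \<Rightarrow> real) \<Rightarrow> 'a set"
  where "SRK ip K I W \<omega> = frame_operator ip I W \<omega> ` range K"

text \<open>The inverse of \<open>S\<^sub>W : R(K) \<rightarrow> S\<^sub>W(R(K))\<close>; meaningful on \<open>SRK\<close> only.\<close>

definition S_inv ::
    "('a \<Rightarrow> 'a \<Rightarrow> 'k::rc_field) \<Rightarrow> ('a \<Rightarrow> 'a) \<Rightarrow> 'i set \<Rightarrow> ('i \<Rightarrow> 'a::real_normed_vector set) \<Rightarrow>
      ('i \<Rightarrow> real) \<Rightarrow> 'a \<Rightarrow> 'a"
  where "S_inv ip K I W \<omega> = inv_into (range K) (frame_operator ip I W \<omega>)"

text \<open>The adjoint \<open>R(K) \<rightarrow> S\<^sub>W(R(K))\<close> of that inverse; meaningful on \<open>range K\<close> only.\<close>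

definition S_inv_adj ::
    "('a \<Rightarrow> 'a \<Rightarrow> 'k::rc_field) \<Rightarrow> ('a \<Rightarrow> 'a) \<Rightarrow> 'i set \<Rightarrow> ('i \<Rightarrow> 'a::real_normed_vector set) \<Rightarrow>
      ('i \<Rightarrow> real) \<Rightarrow> 'a \<Rightarrow> 'a"
  where "S_inv_adj ip K I W \<omega> = adjoint_on ip (SRK ip K I W \<omega>) (S_inv ip K I W \<omega>)"

definition K_dual ::
    "('k::rc_field \<Rightarrow> 'a::real_normed_vector \<Rightarrow> 'a) \<Rightarrow> ('a \<Rightarrow> 'a \<Rightarrow> 'k) \<Rightarrow> ('a \<Rightarrow> 'a) \<Rightarrow>
      'i set \<Rightarrow> ('i \<Rightarrow> 'a set) \<Rightarrow> ('i \<Rightarrow> real) \<Rightarrow> ('i \<Rightarrow> 'a set) \<Rightarrow> ('i \<Rightarrow> real) \<Rightarrow> bool"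
  where "K_dual smul ip K I W \<omega> V \<upsilon> \<longleftrightarrow>
    bessel_fusion_sequence smul ip I V \<upsilon> \<and>
    (\<forall>f. ((\<lambda>i. (\<omega> i * \<upsilon> i) *\<^sub>R
             proj ip (range K) (proj ip (W i) (S_inv_adj ip K I W \<omega> (K (proj ip (V i) f)))))
           has_sum K f) I)"

definition canonical_dual_space ::
    "('a \<Rightarrow> 'a \<Rightarrow> 'k::rc_field) \<Rightarrow> ('a \<Rightarrow> 'a) \<Rightarrow> 'i set \<Rightarrow> ('i \<Rightarrow> 'a::real_normed_vector set) \<Rightarrow>
      ('i \<Rightarrow> real) \<Rightarrow> 'i \<Rightarrow> 'a set"
  where "canonical_dual_space ip K I W \<omega> i =
    (\<lambda>x. adjoint_on ip UNIV K (S_inv ip K I W \<omega> (proj ip (SRK ip K I W \<omega>) x))) ` W i"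

end

theory Submission
  imports Defs
begin

text \<open>
  Write \<open>R\<close> for the range of \<open>K\<close>, \<open>S\<close> for the frame operator of \<open>W\<close>, \<open>M = S R\<close>, \<open>T : M \<rightarrow> R\<close> for the
  inverse of \<open>S\<close>, and \<open>P\<^sub>X\<close> for the orthogonal projection onto \<open>X\<close>. Everything turns on the operator
  \<open>L = T\<^sup>* K\<close> and its adjoint \<open>G = K\<^sup>* T P\<^sub>M\<close>: the canonical dual consists of the subspaces \<open>G W\<^sub>i\<close>, and
  \<open>V\<close> is a dual of \<open>W\<close> iff \<open>\<Sum> \<omega>\<^sub>i\<^sup>2 P\<^sub>R P\<^bsub>W i\<^esub> L P\<^bsub>V i\<^esub> f = K f\<close> for all \<open>f\<close>.

  Since \<open>T P\<^sub>M S\<close> is the identity on \<open>R\<close> and \<open>S\<close> is symmetric, taking adjoints gives \<open>P\<^sub>R S L = K\<close>, that is,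
  the formula holds with \<open>P\<^bsub>V i\<^esub>\<close> omitted. So \<open>V\<close> is a dual iff \<open>\<Sum> \<omega>\<^sub>i\<^sup>2 P\<^sub>R P\<^bsub>W i\<^esub> L d\<^sub>i = 0\<close> for all
  \<open>f\<close>, where \<open>d\<^sub>i = f - P\<^bsub>V i\<^esub> f\<close> ranges over the orthogonal complement of \<open>V\<^sub>i\<close>. If \<open>G W\<^sub>i \<subseteq> V\<^sub>i\<close> then,
  by adjointness, each \<open>P\<^bsub>W i\<^esub> L d\<^sub>i\<close> vanishes. Conversely, the vector \<open>s = \<Sum> \<omega>\<^sub>i\<^sup>2 P\<^bsub>W i\<^esub> L d\<^sub>i\<close>, a
  convergent sum by the Bessel bounds, lies in the closed span of the \<open>W\<^sub>i\<close> and is orthogonal to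
  \<open>R\<close>; the hypothesis on that closed span forces \<open>s = 0\<close>. Each summand is then minus the sum of the
  others, so minimality annihilates it: \<open>P\<^bsub>W i\<^esub> L\<close> is zero on the complement of \<open>V\<^sub>i\<close>. Taking adjoints
  once more, \<open>G W\<^sub>i\<close> is orthogonal to that complement and therefore contained in \<open>V\<^sub>i\<close>.

  For \<open>T\<close> to be a bounded operator on a closed subspace, \<open>S\<close> has to be bounded below on \<open>R\<close>. The lower
  frame bound provides this because the closed range of \<open>K\<close> makes \<open>K\<^sup>*\<close> bounded below on \<open>R\<close>, a
  consequence of the uniform boundedness principle.

  Orthogonality to a subspace, adjoints of homogeneous maps and membership in closed subspaces do not
  change when the inner product \<open>ip\<close> is replaced by its real part, the class operation \<open>inner\<close>; and
  real spans are contained in spans over the scalar field, so the two disjointness hypotheses only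
  become weaker. Hence the analysis is done in real Hilbert spaces (\<open>real_dual_iff\<close>) and transferred.
\<close>

section \<open>Projections, adjoints and uniform boundedness in a real Hilbert space\<close>

lemma proj_eqI:
  fixes V :: "'a::real_inner set"
  assumes "subspace V" "v \<in> V" "\<And>w. w \<in> V \<Longrightarrow> inner (f - v) w = 0"
  shows "proj inner V f = v"
  unfolding proj_def orth_compl_def
proof (rule the_equality)
  show "v \<in> V \<and> f - v \<in> {x. \<forall>y\<in>V. inner x y = 0}"
    using assms by auto
next
  fix u assume u: "u \<in> V \<and> f - u \<in> {x. \<forall>y\<in>V. inner x y = 0}"
  have "u - v \<in> V"
    using u assms by (simp add: subspace_diff)
  hence "inner (f - v) (u - v) = 0" "inner (f - u) (u - v) = 0"
    using u assms(3) by auto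
  hence "inner (u - v) (u - v) = 0"
    by (simp add: inner_diff_left)
  thus "u = v" by simp
qed

text \<open>
  By the parallelogram law, a sequence in \<open>V\<close> that minimizes the distance to \<open>f\<close> is Cauchy.
\<close>

lemma nearest_point_exists:
  fixes V :: "'a::{real_inner,complete_space} set"
  assumes V: "subspace V" "closed V"
  shows "\<exists>v\<in>V. \<forall>w\<in>V. norm (f - v) \<le> norm (f - w)"
proof -
  define D where "D = (INF w\<in>V. (norm (f - w))\<^sup>2)"
  have bdd: "bdd_below ((\<lambda>w. (norm (f - w))\<^sup>2) ` V)"
    by (rule bdd_belowI[of _ 0]) auto
  have ne: "V \<noteq> {}"
    using subspace_0[OF V(1)] by auto
  have D: "D \<le> (norm (f - w))\<^sup>2" if "w \<in> V" for w
    unfolding D_def using bdd that by (rule cINF_lower)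
  have "\<exists>w\<in>V. (norm (f - w))\<^sup>2 < D + 1 / (real n + 1)" for n
    using cINF_less_iff[OF ne bdd, of "D + 1 / (real n + 1)"] unfolding D_def by auto
  then obtain v where v: "\<And>n. v n \<in> V" "\<And>n. (norm (f - v n))\<^sup>2 < D + 1 / (real n + 1)"
    by metis
  have par: "(norm (v m - v n))\<^sup>2 \<le> 2 / (real m + 1) + 2 / (real n + 1)" for m n
  proof -
    have "(1/2) *\<^sub>R (v m + v n) \<in> V"
      using v V by (simp add: subspace_add subspace_scale)
    note D[OF this]
    moreover have "(norm (v m - v n))\<^sup>2 = 2 * (norm (f - v m))\<^sup>2 + 2 * (norm (f - v n))\<^sup>2
        - 4 * (norm (f - (1/2) *\<^sub>R (v m + v n)))\<^sup>2"
      by (simp add: power2_norm_eq_inner inner_simps inner_commute algebra_simps)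
    ultimately show ?thesis
      using v(2)[of m] v(2)[of n] by simp
  qed
  have "Cauchy v"
  proof (rule metric_CauchyI)
    fix e :: real assume "e > 0"
    obtain N where N: "4 / e\<^sup>2 < real N"
      using reals_Archimedean2 by blast
    show "\<exists>M. \<forall>m\<ge>M. \<forall>n\<ge>M. dist (v m) (v n) < e"
    proof (intro exI allI impI)
      fix m n assume mn: "N \<le> m" "N \<le> n"
      have "2 / (real m + 1) \<le> 2 / (real N + 1)" "2 / (real n + 1) \<le> 2 / (real N + 1)"
        using mn by (auto intro!: divide_left_mono)
      moreover have "4 / (real N + 1) < e\<^sup>2"
        using N \<open>e > 0\<close> by (simp add: field_simps) (smt (verit) zero_less_power)
      ultimately have "(norm (v m - v n))\<^sup>2 < e\<^sup>2"
        using par[of m n] by simp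
      thus "dist (v m) (v n) < e"
        using \<open>e > 0\<close> by (simp add: dist_norm power_less_imp_less_base)
    qed
  qed
  then obtain l where l: "v \<longlonglongrightarrow> l"
    using Cauchy_convergent convergent_def by blast
  have "l \<in> V"
    using closed_sequentially[OF V(2)] v(1) l by blast
  have lim: "(\<lambda>n. (norm (f - v n))\<^sup>2) \<longlonglongrightarrow> (norm (f - l))\<^sup>2"
    by (intro tendsto_intros l)
  have "(\<lambda>n. D + 1 / (real n + 1)) \<longlonglongrightarrow> D + 0"
    using LIMSEQ_inverse_real_of_nat by (intro tendsto_add tendsto_const)
      (simp add: inverse_eq_divide add.commute)
  hence "(\<lambda>n. D + 1 / (real n + 1)) \<longlonglongrightarrow> D" by simp
  hence "(norm (f - l))\<^sup>2 \<le> D"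
    by (rule LIMSEQ_le[OF lim]) (intro exI[of _ 0] allI impI less_imp_le v(2))
  hence "norm (f - l) \<le> norm (f - w)" if "w \<in> V" for w
    using D[OF that] by (meson norm_ge_zero order_trans power2_le_imp_le)
  with \<open>l \<in> V\<close> show ?thesis by blast
qed

text \<open>
  If \<open>f - v\<close> had a component along \<open>w\<close>, moving \<open>v\<close> in that direction would bring it closer to \<open>f\<close>.
\<close>

lemma nearest_point_orthogonal:
  fixes V :: "'a::real_inner set"
  assumes "subspace V" "v \<in> V" and near: "\<And>w. w \<in> V \<Longrightarrow> norm (f - v) \<le> norm (f - w)" and "w \<in> V"
  shows "inner (f - v) w = 0"
proof (cases "w = 0")
  case False
  define a t where "a = inner (f - v) w" and "t = inner (f - v) w / (norm w)\<^sup>2"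
  have pos: "(norm w)\<^sup>2 > 0" using False by simp
  \<comment> \<open>\<open>t\<close> minimizes the quadratic \<open>\<parallel>f - v - t w\<parallel>\<^sup>2\<close>.\<close>
  have "v + t *\<^sub>R w \<in> V"
    using assms by (simp add: subspace_add subspace_scale)
  hence "(norm (f - v))\<^sup>2 \<le> (norm ((f - v) - t *\<^sub>R w))\<^sup>2"
    using near by (metis diff_diff_add norm_ge_zero power_mono)
  also have "\<dots> = (norm (f - v))\<^sup>2 - 2 * t * a + t\<^sup>2 * (norm w)\<^sup>2"
    unfolding a_def power2_norm_eq_inner
    by (simp add: inner_simps inner_commute algebra_simps power2_eq_square)
  also have "\<dots> = (norm (f - v))\<^sup>2 - a\<^sup>2 / (norm w)\<^sup>2"
    unfolding t_def a_def using pos by (simp add: field_simps power2_eq_square)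
  finally have "a\<^sup>2 / (norm w)\<^sup>2 \<le> 0" by simp
  thus ?thesis
    using pos by (simp add: a_def divide_le_0_iff)
qed simp

context
  fixes V :: "'a::{real_inner,complete_space} set"
  assumes V: "subspace V" "closed V"
begin

lemma proj_in: "proj inner V f \<in> V" (is ?A)
  and proj_orthogonal: "w \<in> V \<Longrightarrow> inner (f - proj inner V f) w = 0" (is "_ \<Longrightarrow> ?B")
proof -
  obtain v where v: "v \<in> V" "\<And>w. w \<in> V \<Longrightarrow> norm (f - v) \<le> norm (f - w)"
    using nearest_point_exists[OF V] by blast
  note o = nearest_point_orthogonal[OF V(1) v]
  have "proj inner V f = v"
    using V(1) v(1) o by (rule proj_eqI)
  thus ?A "w \<in> V \<Longrightarrow> ?B" using v(1) o by auto
qed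

lemma proj_id: "f \<in> V \<Longrightarrow> proj inner V f = f"
  using V by (intro proj_eqI) auto

lemma proj_eq_0: "(\<And>w. w \<in> V \<Longrightarrow> inner f w = 0) \<Longrightarrow> proj inner V f = 0"
  using V by (intro proj_eqI) (auto simp: subspace_0)

lemma inner_proj_left: "w \<in> V \<Longrightarrow> inner (proj inner V f) w = inner f w"
  using proj_orthogonal[of w f] by (simp add: inner_diff_left)

lemma inner_proj_commute: "inner (proj inner V f) g = inner f (proj inner V g)"
  using inner_proj_left[OF proj_in, of f g] inner_proj_left[OF proj_in, of g f]
  by (simp add: inner_commute)

lemma inner_proj_self: "inner f (proj inner V f) = (norm (proj inner V f))\<^sup>2"
  using inner_proj_left[OF proj_in, of f f] by (simp add: power2_norm_eq_inner)

text \<open>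
  The inclusion of the double orthogonal complement of a closed subspace in the subspace; this is how
  membership in a dual subspace is obtained from orthogonality relations.
\<close>

lemma mem_if_orthogonal_to_orthogonal:
  assumes "\<And>y. (\<And>w. w \<in> V \<Longrightarrow> inner y w = 0) \<Longrightarrow> inner y x = 0"
  shows "x \<in> V"
proof -
  let ?d = "x - proj inner V x"
  have "inner ?d x = 0" "inner ?d (proj inner V x) = 0"
    using assms proj_orthogonal proj_in by blast+
  hence "inner ?d ?d = 0" by (simp add: inner_diff_right)
  hence "x = proj inner V x" by simp
  thus ?thesis using proj_in[of x] by simp
qed

end

text \<open>
  A nonzero functional is determined by its kernel up to a factor, and \<open>e\<close>, orthogonal to the kernel,
  represents it after scaling.
\<close>

lemma riesz_representation:
  fixes \<phi> :: "'a::{real_inner,complete_space} \<Rightarrow> real"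
  assumes "bounded_linear \<phi>"
  shows "\<exists>z. \<forall>x. \<phi> x = inner x z"
proof (cases "\<forall>x. \<phi> x = 0")
  case True
  thus ?thesis by (intro exI[of _ 0]) simp
next
  case False
  then obtain x0 where x0: "\<phi> x0 \<noteq> 0" by blast
  interpret bounded_linear \<phi> by fact
  define N where "N = {x. \<phi> x = 0}"
  have "subspace N"
    unfolding N_def by (rule subspaceI) (auto simp: add scaleR zero)
  moreover have "closed N"
    unfolding N_def by (rule closed_Collect_eq) (auto intro: linear_continuous_on assms)
  ultimately have N: "subspace N" "closed N" .
  define e where "e = x0 - proj inner N x0"
  have "\<phi> (proj inner N x0) = 0"
    using proj_in[OF N] by (auto simp: N_def)
  hence e: "\<phi> e \<noteq> 0" "e \<noteq> 0"
    using x0 by (auto simp: e_def diff zero)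
  have "\<phi> x = inner x ((\<phi> e / (norm e)\<^sup>2) *\<^sub>R e)" for x
  proof -
    have "x - (\<phi> x / \<phi> e) *\<^sub>R e \<in> N"
      using e by (simp add: N_def diff scaleR)
    hence "inner e (x - (\<phi> x / \<phi> e) *\<^sub>R e) = 0"
      unfolding e_def by (rule proj_orthogonal[OF N])
    hence "inner x e = \<phi> x / \<phi> e * (norm e)\<^sup>2"
      by (simp add: inner_simps power2_norm_eq_inner inner_commute)
    thus ?thesis using e by simp
  qed
  thus ?thesis by blast
qed

text \<open>
  The uniform boundedness principle for functionals, identified with their representing vectors. The
  closed sets \<open>E n\<close> on which all of \<open>F\<close> is bounded by \<open>n\<close> cover the space, so by Baire one contains a
  ball; linearity turns the bound on this ball into a bound on norms.
\<close>

lemma pointwise_bounded_imp_bounded: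
  fixes F :: "'a::{real_inner,complete_space} set"
  assumes "\<And>y. \<exists>C. \<forall>f\<in>F. \<bar>inner f y\<bar> \<le> C"
  shows "bounded F"
proof -
  define E where "E = (\<lambda>n::nat. \<Inter>f\<in>F. {y. \<bar>inner f y\<bar> \<le> real n})"
  have E: "closed (E n)" for n
    unfolding E_def by (intro closed_INT ballI closed_Collect_le continuous_intros)
  have "y \<in> \<Union>(range E)" for y
  proof -
    obtain C where C: "\<forall>f\<in>F. \<bar>inner f y\<bar> \<le> C" using assms by blast
    obtain n where "C \<le> real n" using real_arch_simple by blast
    hence "y \<in> E n" using C by (force simp: E_def)
    thus ?thesis by blast
  qed
  hence U: "\<Union>(range E) = UNIV" by blast
  have "\<exists>n. interior (E n) \<noteq> {}"
  proof (rule ccontr)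
    assume "\<not> ?thesis"
    hence "(euclidean :: 'a topology) interior_of \<Union>(range E) = {}"
      using E by (intro Baire_category_alt) (auto simp: completely_metrizable_space_euclidean)
    thus False by (simp add: U)
  qed
  then obtain n x r where r: "r > 0" "cball x r \<subseteq> E n"
    by (meson ex_in_conv mem_interior_cball)
  have "norm f \<le> 2 * real n / r" if f: "f \<in> F" for f
  proof (cases "f = 0")
    case False
    have bd: "\<bar>inner f y\<bar> \<le> real n" if "y \<in> cball x r" for y
      using r(2) that f unfolding E_def by blast
    define y where "y = x + (r / norm f) *\<^sub>R f"
    have "y \<in> cball x r" "x \<in> cball x r"
      using r(1) False by (auto simp: y_def dist_norm)
    from this[THEN bd] have "inner f (y - x) \<le> 2 * real n"
      by (simp add: inner_diff_right)
    moreover have "inner f (y - x) = r * norm f"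
      using False by (simp add: y_def dot_square_norm power2_eq_square)
    ultimately show ?thesis using r(1) by (simp add: field_simps)
  qed (use r in auto)
  thus ?thesis by (auto simp: bounded_iff)
qed

text \<open>
  The Hellinger--Toeplitz theorem: having an everywhere defined adjoint makes a map linear (test
  against all \<open>y\<close>) and bounded (apply uniform boundedness to the image of the unit ball). It yields
  the continuity of projections, of the frame operator and of \<open>L\<close> from their adjoint identities.
\<close>

lemma adjoint_pair_bounded_linear:
  fixes T T' :: "'a::{real_inner,complete_space} \<Rightarrow> 'a"
  assumes adj: "\<And>x y. inner (T x) y = inner x (T' y)"
  shows "bounded_linear T"
proof -
  have add: "T (x + y) = T x + T y" for x y
    by (rule vector_eq_rdot[THEN iffD1]) (simp add: adj inner_add_left)
  have sc: "T (c *\<^sub>R x) = c *\<^sub>R T x" for c x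
    by (rule vector_eq_rdot[THEN iffD1]) (simp add: adj)
  have "bounded (T ` cball 0 1)"
  proof (rule pointwise_bounded_imp_bounded)
    fix y
    show "\<exists>C. \<forall>f\<in>T ` cball 0 1. \<bar>inner f y\<bar> \<le> C"
    proof (intro exI ballI)
      fix f assume "f \<in> T ` cball 0 1"
      then obtain x where x: "f = T x" "norm x \<le> 1" by auto
      have "\<bar>inner f y\<bar> \<le> norm x * norm (T' y)"
        unfolding x adj by (rule Cauchy_Schwarz_ineq2)
      also have "\<dots> \<le> 1 * norm (T' y)"
        using x(2) by (rule mult_right_mono) simp
      finally show "\<bar>inner f y\<bar> \<le> norm (T' y)" by simp
    qed
  qed
  then obtain B where "\<forall>x\<in>cball 0 1. norm (T x) \<le> B"
    by (auto simp: bounded_iff)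
  hence B: "norm (T x) \<le> B" if "norm x \<le> 1" for x
    using that by simp
  have "norm (T x) \<le> norm x * B" for x
  proof (cases "x = 0")
    case True
    thus ?thesis using sc[of 0 0] by simp
  next
    case False
    have "norm (T ((1 / norm x) *\<^sub>R x)) \<le> B"
      using False by (intro B) simp
    thus ?thesis using False by (simp add: sc field_simps)
  qed
  thus ?thesis
    using add sc by (intro bounded_linear_intro[of _ B]) auto
qed

lemma adjoint_on_UNIV:
  fixes T :: "'a::{real_inner,complete_space} \<Rightarrow> 'a"
  assumes "bounded_linear T"
  shows "inner (T x) y = inner x (adjoint_on inner UNIV T y)"
proof -
  have "bounded_linear (\<lambda>x. inner (T x) y)"
    by (rule bounded_linear_compose[OF bounded_linear_inner_left assms])
  then obtain z where z: "\<And>x. inner (T x) y = inner x z"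
    using riesz_representation by blast
  have "adjoint_on inner UNIV T y = z"
    unfolding adjoint_on_def by (rule the_equality) (auto simp: z vector_eq_ldot)
  thus ?thesis by (simp add: z)
qed

text \<open>
  This reduces the adjoint of an operator that is only meaningful on \<open>U\<close> to that of an everywhere
  defined operator: the latter vanishes on the complement of \<open>U\<close>, so its adjoint takes values in \<open>U\<close>.
\<close>

lemma adjoint_on_subspace:
  fixes T :: "'a::{real_inner,complete_space} \<Rightarrow> 'a"
  assumes U: "subspace U" "closed U" and T: "bounded_linear (\<lambda>x. T (proj inner U x))"
  shows "adjoint_on inner U T y = adjoint_on inner UNIV (\<lambda>x. T (proj inner U x)) y"
proof -
  define z where "z = adjoint_on inner UNIV (\<lambda>x. T (proj inner U x)) y"
  have z: "inner (T (proj inner U x)) y = inner x z" for x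
    unfolding z_def by (rule adjoint_on_UNIV[OF T])
  have zU: "z \<in> U"
  proof (rule mem_if_orthogonal_to_orthogonal[OF U])
    fix x assume "\<And>w. w \<in> U \<Longrightarrow> inner x w = 0"
    hence "proj inner U x = 0" by (rule proj_eq_0[OF U])
    thus "inner x z = 0"
      using z[of x] z[of 0] by (simp add: proj_id[OF U] subspace_0 U)
  qed
  have "adjoint_on inner U T y = z"
    unfolding adjoint_on_def
  proof (rule the_equality)
    show "z \<in> U \<and> (\<forall>x\<in>U. inner (T x) y = inner x z)"
      using zU z by (metis proj_id[OF U])
  next
    fix u assume u: "u \<in> U \<and> (\<forall>x\<in>U. inner (T x) y = inner x u)"
    have "u - z \<in> U" using u zU U by (simp add: subspace_diff)
    hence "inner (u - z) u = inner (u - z) z"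
      using u z[of "u - z"] by (simp add: proj_id[OF U])
    hence "inner (u - z) (u - z) = 0" by (simp add: inner_diff_right)
    thus "u = z" by simp
  qed
  thus ?thesis by (simp add: z_def)
qed

text \<open>
  Let \<open>f\<close> be in the range with \<open>\<parallel>K\<^sup>* f\<parallel> \<le> 1\<close>. As the range is closed, every \<open>y\<close> projects onto some \<open>K x\<close>
  in it, so \<open>inner f y = inner f (K x) = inner (K\<^sup>* f) x\<close> is at most \<open>\<parallel>x\<parallel>\<close>, whatever \<open>f\<close> is. Uniform
  boundedness then bounds \<open>\<parallel>f\<parallel>\<close>.
\<close>

lemma adjoint_bounded_below_of_closed_range:
  fixes K :: "'a::{real_inner,complete_space} \<Rightarrow> 'a"
  assumes K: "bounded_linear K" and cl: "closed (range K)"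
  shows "\<exists>C>0. \<forall>f\<in>range K. norm f \<le> C * norm (adjoint_on inner UNIV K f)"
proof -
  let ?A = "adjoint_on inner UNIV K"
  interpret bounded_linear K by fact
  have R: "subspace (range K)" "closed (range K)"
    using cl linear_axioms by (auto intro: linear_subspace_image)
  have adj: "inner (K x) y = inner x (?A y)" for x y
    by (rule adjoint_on_UNIV[OF K])
  define F where "F = {f \<in> range K. norm (?A f) \<le> 1}"
  have A: "bounded_linear ?A"
    by (rule adjoint_pair_bounded_linear[of _ K]) (metis adj inner_commute)
  interpret A: bounded_linear ?A by fact
  have "bounded F"
  proof (rule pointwise_bounded_imp_bounded)
    fix y
    obtain x where x: "proj inner (range K) y = K x"
      using proj_in[OF R, of y] by blast
    show "\<exists>C. \<forall>f\<in>F. \<bar>inner f y\<bar> \<le> C"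
    proof (intro exI ballI)
      fix f assume f: "f \<in> F"
      have "inner f y = inner (K x) f"
        using inner_proj_left[OF R, of f y] f x by (simp add: F_def inner_commute)
      also have "\<dots> = inner x (?A f)" by (rule adj)
      finally have "\<bar>inner f y\<bar> \<le> norm x * norm (?A f)"
        using Cauchy_Schwarz_ineq2 by simp
      also have "\<dots> \<le> norm x * 1"
        using f by (intro mult_left_mono) (auto simp: F_def)
      finally show "\<bar>inner f y\<bar> \<le> norm x" by simp
    qed
  qed
  then obtain C where C: "C > 0" "\<And>f. f \<in> F \<Longrightarrow> norm f \<le> C"
    by (auto simp: bounded_pos)
  have "norm f \<le> C * norm (?A f)" if f: "f \<in> range K" for f
  proof (cases "?A f = 0")
    case True
    obtain x where "f = K x" using f by blast
    hence "inner f f = 0" using adj[of x f] True by simp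
    thus ?thesis using C(1) by simp
  next
    case False
    have "(1 / norm (?A f)) *\<^sub>R f \<in> F"
      using f False by (auto simp: F_def A.scaleR intro: subspace_scale[OF R(1)])
    from C(2)[OF this] show ?thesis
      using False by (simp add: field_simps)
  qed
  with C(1) show ?thesis by blast
qed

section \<open>Unconditional sums\<close>

lemma has_sum_in_closure_span:
  fixes f :: "'i \<Rightarrow> 'a::real_normed_vector"
  assumes "(f has_sum s) I" "\<And>i. i \<in> I \<Longrightarrow> f i \<in> X"
  shows "s \<in> closure (span X)"
proof (rule Lim_in_closed_set)
  show "(sum f \<longlongrightarrow> s) (finite_subsets_at_top I)"
    using assms(1) by (simp add: has_sum_def)
  show "\<forall>\<^sub>F F in finite_subsets_at_top I. sum f F \<in> closure (span X)"
    using assms(2) by (intro eventually_finite_subsets_at_top_weakI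
        subsetD[OF closure_subset] span_sum span_base) blast
qed auto

text \<open>
  The form in which a Bessel bound implies unconditional convergence: the tails of \<open>g\<close> control those
  of \<open>f\<close>, so the net of finite partial sums of \<open>f\<close> is Cauchy. Summability of the norms of \<open>f\<close> would be
  too much to ask.
\<close>

lemma summable_on_if_square_dominated:
  fixes f :: "'i \<Rightarrow> 'a::{real_normed_vector,complete_space}" and g :: "'i \<Rightarrow> real"
  assumes g: "g summable_on I" "\<And>i. i \<in> I \<Longrightarrow> g i \<ge> 0" and "B \<ge> 0"
    and dom: "\<And>F. finite F \<Longrightarrow> F \<subseteq> I \<Longrightarrow> (norm (sum f F))\<^sup>2 \<le> B * sum g F"
  shows "f summable_on I"
proof -
  have "\<exists>P. eventually P (finite_subsets_at_top I) \<and>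
      (\<forall>F F'. P F \<and> P F' \<longrightarrow> dist (sum f F) (sum f F') < e)" if "e > 0" for e
  proof -
    define d where "d = (e/2)\<^sup>2 / (B + 1)"
    have "d > 0" using \<open>e > 0\<close> \<open>B \<ge> 0\<close> by (simp add: d_def)
    obtain F0 where F0: "finite F0" "F0 \<subseteq> I" "dist (sum g F0) (infsum g I) \<le> d"
      using infsum_finite_approximation[OF g(1) \<open>d > 0\<close>] by blast
    have near: "dist (sum f F) (sum f F0) < e / 2" if F: "finite F" "F0 \<subseteq> F" "F \<subseteq> I" for F
    proof -
      have "sum g F \<le> infsum g I"
        using g F by (intro finite_sum_le_infsum) auto
      moreover have "sum g (F - F0) = sum g F - sum g F0"
        using F by (simp add: sum_diff)
      ultimately have "sum g (F - F0) \<le> d"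
        using F0(3) by (simp add: dist_real_def)
      have "(norm (sum f (F - F0)))\<^sup>2 \<le> B * sum g (F - F0)"
        using F by (intro dom) auto
      also have "\<dots> \<le> B * d"
        using \<open>sum g (F - F0) \<le> d\<close> \<open>B \<ge> 0\<close> by (rule mult_left_mono)
      also have "\<dots> < (B + 1) * d"
        using \<open>d > 0\<close> by (simp add: algebra_simps)
      also have "\<dots> = (e/2)\<^sup>2"
        using \<open>B \<ge> 0\<close> by (simp add: d_def)
      finally have "norm (sum f (F - F0)) < e / 2"
        by (rule power_less_imp_less_base) (use \<open>e > 0\<close> in simp)
      thus ?thesis
        using F by (simp add: dist_norm sum_diff)
    qed
    let ?P = "\<lambda>F. finite F \<and> F0 \<subseteq> F \<and> F \<subseteq> I"
    have "eventually ?P (finite_subsets_at_top I)"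
      using F0 by (auto simp: eventually_finite_subsets_at_top)
    moreover have "dist (sum f F) (sum f F') < e" if "?P F" "?P F'" for F F'
    proof -
      have "dist (sum f F) (sum f F0) < e / 2" "dist (sum f F') (sum f F0) < e / 2"
        using that by (blast intro: near)+
      thus ?thesis by (rule dist_triangle_half_l)
    qed
    ultimately show ?thesis by (intro exI[of _ ?P]) simp
  qed
  hence "cauchy_filter (filtermap (sum f) (finite_subsets_at_top I))"
    by (simp add: cauchy_filter_metric_filtermap)
  hence "convergent_filter (filtermap (sum f) (finite_subsets_at_top I))"
    by (rule cauchy_filter_convergent)
  thus ?thesis
    by (auto simp: convergent_filter_iff summable_on_def has_sum_def filterlim_def)
qed

section \<open>Frame operator of a Bessel fusion sequence\<close>

lemma bounded_linear_proj:
  fixes V :: "'a::{real_inner,complete_space} set"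
  assumes "subspace V" "closed V"
  shows "bounded_linear (proj inner V)"
  using adjoint_pair_bounded_linear inner_proj_commute[OF assms] .

locale real_bessel_fusion_sequence =
  fixes I :: "'i set" and W :: "'i \<Rightarrow> 'a::{real_inner,complete_space} set"
    and \<omega> :: "'i \<Rightarrow> real" and B :: real
  assumes subspace: "i \<in> I \<Longrightarrow> subspace (W i)"
    and closed: "i \<in> I \<Longrightarrow> closed (W i)"
    and weight_pos: "i \<in> I \<Longrightarrow> \<omega> i > 0"
    and summable: "(\<lambda>i. (\<omega> i)\<^sup>2 * (norm (proj inner (W i) f))\<^sup>2) summable_on I"
    and bound: "(\<Sum>\<^sub>\<infinity>i\<in>I. (\<omega> i)\<^sup>2 * (norm (proj inner (W i) f))\<^sup>2) \<le> B * (norm f)\<^sup>2"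
    and bound_nonneg: "B \<ge> 0"
begin

abbreviation "P i \<equiv> proj inner (W i)"
abbreviation "S \<equiv> frame_operator inner I W \<omega>"

text \<open>
  The synthesis operator is the adjoint of the analysis operator, and so inherits its norm bound:
  pair the sum \<open>g\<close> with itself, move the projections to the other side, and apply the Cauchy--Schwarz
  inequality and the Bessel inequality for \<open>g\<close>.
\<close>

lemma synthesis_bound:
  assumes F: "finite F" "F \<subseteq> I"
  shows "(norm (\<Sum>i\<in>F. \<omega> i *\<^sub>R P i (c i)))\<^sup>2 \<le> B * (\<Sum>i\<in>F. (norm (c i))\<^sup>2)"
proof -
  define g where "g = (\<Sum>i\<in>F. \<omega> i *\<^sub>R P i (c i))"
  have "(norm g)\<^sup>2 = (\<Sum>i\<in>F. \<omega> i * inner (P i (c i)) g)"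
    by (simp add: power2_norm_eq_inner g_def inner_sum_left)
  also have "\<dots> = (\<Sum>i\<in>F. inner (c i) (\<omega> i *\<^sub>R P i g))"
    using F by (intro sum.cong refl) (auto simp: inner_proj_commute subspace closed)
  also have "\<dots> \<le> (\<Sum>i\<in>F. norm (c i) * norm (\<omega> i *\<^sub>R P i g))"
    by (intro sum_mono norm_cauchy_schwarz)
  finally have "((norm g)\<^sup>2)\<^sup>2 \<le> (\<Sum>i\<in>F. norm (c i) * norm (\<omega> i *\<^sub>R P i g))\<^sup>2"
    by (rule power_mono) simp
  also have "\<dots> \<le> (\<Sum>i\<in>F. (norm (c i))\<^sup>2) * (\<Sum>i\<in>F. (norm (\<omega> i *\<^sub>R P i g))\<^sup>2)"
    by (rule Cauchy_Schwarz_ineq_sum)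
  also have "(\<Sum>i\<in>F. (norm (\<omega> i *\<^sub>R P i g))\<^sup>2) \<le> B * (norm g)\<^sup>2"
  proof -
    have "(\<Sum>i\<in>F. (\<omega> i)\<^sup>2 * (norm (P i g))\<^sup>2) \<le> (\<Sum>\<^sub>\<infinity>i\<in>I. (\<omega> i)\<^sup>2 * (norm (P i g))\<^sup>2)"
      using F summable by (intro finite_sum_le_infsum) auto
    also have "\<dots> \<le> B * (norm g)\<^sup>2" by (rule bound)
    finally show ?thesis by (simp add: power_mult_distrib)
  qed
  finally have *: "((norm g)\<^sup>2)\<^sup>2 \<le> (\<Sum>i\<in>F. (norm (c i))\<^sup>2) * (B * (norm g)\<^sup>2)"
    by (simp add: mult_left_mono sum_nonneg)
  show ?thesis
  proof (cases "g = 0")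
    case True
    thus ?thesis
      using bound_nonneg by (simp add: g_def[symmetric] sum_nonneg)
  next
    case False
    have "(norm g)\<^sup>2 * (norm g)\<^sup>2 \<le> (B * (\<Sum>i\<in>F. (norm (c i))\<^sup>2)) * (norm g)\<^sup>2"
      using * by (simp add: power2_eq_square mult_ac)
    moreover have "(norm g)\<^sup>2 > 0" using False by simp
    ultimately show ?thesis
      unfolding g_def[symmetric] by (rule mult_right_le_imp_le)
  qed
qed

lemma synthesis_summable:
  assumes "(\<lambda>i. (norm (c i))\<^sup>2) summable_on I"
  shows "(\<lambda>i. \<omega> i *\<^sub>R P i (c i)) summable_on I"
  by (rule summable_on_if_square_dominated[OF assms _ bound_nonneg synthesis_bound]) auto

lemma frame_operator_has_sum: "((\<lambda>i. (\<omega> i)\<^sup>2 *\<^sub>R P i f) has_sum S f) I"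
proof -
  \<comment> \<open>The frame operator is synthesis applied to the square-summable coefficients \<open>\<omega>\<^sub>i P\<^sub>i f\<close>.\<close>
  have "(\<lambda>i. \<omega> i *\<^sub>R P i (\<omega> i *\<^sub>R P i f)) summable_on I"
    using summable[of f] by (intro synthesis_summable) (simp add: power_mult_distrib)
  moreover have "\<omega> i *\<^sub>R P i (\<omega> i *\<^sub>R P i f) = (\<omega> i)\<^sup>2 *\<^sub>R P i f" if "i \<in> I" for i
  proof -
    note [simp] = subspace[OF that] closed[OF that]
    interpret P: bounded_linear "P i" by (simp add: bounded_linear_proj)
    show ?thesis
      by (simp add: P.scaleR proj_id proj_in power2_eq_square)
  qed
  ultimately have "(\<lambda>i. (\<omega> i)\<^sup>2 *\<^sub>R P i f) summable_on I"
    by (simp cong: summable_on_cong)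
  thus ?thesis
    by (simp add: frame_operator_def summable_iff_has_sum_infsum)
qed

lemma inner_frame_operator_has_sum:
  "((\<lambda>i. (\<omega> i)\<^sup>2 * inner (P i f) g) has_sum inner (S f) g) I"
proof -
  have "((\<lambda>i. inner ((\<omega> i)\<^sup>2 *\<^sub>R P i f) g) has_sum inner (S f) g) I"
    by (rule has_sum_bounded_linear[OF bounded_linear_inner_left frame_operator_has_sum])
  thus ?thesis by simp
qed

lemma frame_operator_symmetric: "inner (S f) g = inner f (S g)"
proof -
  have eq: "(\<omega> i)\<^sup>2 * inner (P i f) g = (\<omega> i)\<^sup>2 * inner (P i g) f" if "i \<in> I" for i
    using inner_proj_commute[OF subspace[OF that] closed[OF that]] by (simp add: inner_commute)
  have "((\<lambda>i. (\<omega> i)\<^sup>2 * inner (P i f) g) has_sum inner (S g) f) I"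
    using inner_frame_operator_has_sum by (subst has_sum_cong[OF eq])
  thus ?thesis
    using has_sum_unique[OF inner_frame_operator_has_sum] by (simp add: inner_commute)
qed

lemma bounded_linear_frame_operator: "bounded_linear S"
  using adjoint_pair_bounded_linear frame_operator_symmetric .

lemma inner_frame_operator_self: "inner (S f) f = (\<Sum>\<^sub>\<infinity>i\<in>I. (\<omega> i)\<^sup>2 * (norm (P i f))\<^sup>2)"
proof -
  have eq: "(\<omega> i)\<^sup>2 * (norm (P i f))\<^sup>2 = (\<omega> i)\<^sup>2 * inner (P i f) f" if "i \<in> I" for i
    using inner_proj_self[OF subspace[OF that] closed[OF that]] by (simp add: inner_commute)
  have "((\<lambda>i. (\<omega> i)\<^sup>2 * (norm (P i f))\<^sup>2) has_sum inner (S f) f) I"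
    using inner_frame_operator_has_sum by (subst has_sum_cong[OF eq])
  thus ?thesis by (simp add: infsumI)
qed

end

section \<open>Inverting the frame operator on the range of K\<close>

locale real_K_fusion_frame = real_bessel_fusion_sequence I W \<omega> B
  for I :: "'i set" and W :: "'i \<Rightarrow> 'a::{real_inner,complete_space} set" and \<omega> B +
  fixes K :: "'a \<Rightarrow> 'a" and A :: real
  assumes bounded_linear_K: "bounded_linear K"
    and closed_range: "closed (range K)"
    and lower_pos: "A > 0"
    and lower: "A * (norm (adjoint_on inner UNIV K f))\<^sup>2
       \<le> (\<Sum>\<^sub>\<infinity>i\<in>I. (\<omega> i)\<^sup>2 * (norm (proj inner (W i) f))\<^sup>2)"
begin

abbreviation "R \<equiv> range K"
abbreviation "M \<equiv> SRK inner K I W \<omega>"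
abbreviation "T \<equiv> S_inv inner K I W \<omega>"
abbreviation "Kadj \<equiv> adjoint_on inner UNIV K"
text \<open>\<open>L\<close> and \<open>G\<close> are adjoint to each other; \<open>G\<close> maps \<open>W i\<close> onto the canonical dual subspace.\<close>

abbreviation "L f \<equiv> S_inv_adj inner K I W \<omega> (K f)"
abbreviation "G x \<equiv> Kadj (T (proj inner M x))"

lemma subspace_R: "subspace R"
proof -
  interpret K: bounded_linear K by (rule bounded_linear_K)
  show ?thesis using K.linear_axioms by (auto intro: linear_subspace_image)
qed

text \<open>
  Combine \<open>A \<parallel>K\<^sup>* f\<parallel>\<^sup>2 \<le> inner (S f) f \<le> \<parallel>S f\<parallel> \<parallel>f\<parallel>\<close> with the lower bound for \<open>\<parallel>K\<^sup>* f\<parallel>\<close> on the closed range.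
\<close>

lemma frame_operator_bounded_below: "\<exists>c>0. \<forall>f\<in>R. c * norm f \<le> norm (S f)"
proof -
  obtain C where C: "C > 0" "\<And>f. f \<in> R \<Longrightarrow> norm f \<le> C * norm (Kadj f)"
    using adjoint_bounded_below_of_closed_range[OF bounded_linear_K closed_range] by blast
  have "A / C\<^sup>2 * norm f \<le> norm (S f)" if f: "f \<in> R" for f
  proof (cases "f = 0")
    case False
    have "(norm f)\<^sup>2 \<le> (C * norm (Kadj f))\<^sup>2"
      using C(2)[OF f] by (intro power_mono) auto
    hence "A / C\<^sup>2 * (norm f)\<^sup>2 \<le> A / C\<^sup>2 * (C * norm (Kadj f))\<^sup>2"
      using lower_pos by (intro mult_left_mono) auto
    also have "\<dots> = A * (norm (Kadj f))\<^sup>2"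
      using C(1) by (simp add: power_mult_distrib)
    also have "\<dots> \<le> inner (S f) f"
      unfolding inner_frame_operator_self by (rule lower)
    also have "\<dots> \<le> norm (S f) * norm f"
      by (rule norm_cauchy_schwarz)
    finally have "(A / C\<^sup>2 * norm f) * norm f \<le> norm (S f) * norm f"
      by (simp add: power2_eq_square mult_ac)
    moreover have "norm f > 0" using False by simp
    ultimately show ?thesis by (rule mult_right_le_imp_le)
  qed simp
  moreover have "A / C\<^sup>2 > 0" using C lower_pos by simp
  ultimately show ?thesis by blast
qed

lemma inj_on_frame_operator: "inj_on S R"
proof (rule inj_onI)
  interpret S: bounded_linear S by (rule bounded_linear_frame_operator)
  fix x y assume xy: "x \<in> R" "y \<in> R" "S x = S y"
  obtain c where c: "c > 0" "\<And>f. f \<in> R \<Longrightarrow> c * norm f \<le> norm (S f)"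
    using frame_operator_bounded_below by blast
  have "x - y \<in> R"
    using xy subspace_R by (simp add: subspace_diff)
  from c(2)[OF this] show "x = y"
    using c(1) xy(3) by (simp add: S.diff mult_le_0_iff)
qed

lemma S_inv_frame_operator: "x \<in> R \<Longrightarrow> T (S x) = x"
  unfolding S_inv_def using inj_on_frame_operator by (rule inv_into_f_f)

lemma S_inv_in: "y \<in> M \<Longrightarrow> T y \<in> R" and frame_operator_S_inv: "y \<in> M \<Longrightarrow> S (T y) = y"
  unfolding S_inv_def SRK_def by (rule inv_into_into, assumption) (rule f_inv_into_f)

lemma subspace_M: "subspace M"
proof -
  interpret S: bounded_linear S by (rule bounded_linear_frame_operator)
  show ?thesis
    unfolding SRK_def using S.linear_axioms subspace_R by (rule linear_subspace_image)
qed

lemma closed_M: "closed M"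
proof -
  obtain c where c: "c > 0" "\<forall>f\<in>R. c * norm f \<le> norm (S f)"
    using frame_operator_bounded_below by blast
  have "complete R"
    using closed_range by (simp add: complete_eq_closed)
  hence "complete M"
    unfolding SRK_def
    using complete_isometric_image[OF c(1) subspace_R bounded_linear_frame_operator c(2)] by blast
  thus ?thesis by (rule complete_imp_closed)
qed

lemma bounded_linear_S_inv_proj: "bounded_linear (\<lambda>x. T (proj inner M x))"
proof -
  interpret S: bounded_linear S by (rule bounded_linear_frame_operator)
  interpret Q: bounded_linear "proj inner M"
    by (rule bounded_linear_proj[OF subspace_M closed_M])
  obtain c where c: "c > 0" "\<And>f. f \<in> R \<Longrightarrow> c * norm f \<le> norm (S f)"
    using frame_operator_bounded_below by blast
  obtain q where q: "q > 0" "\<And>x. norm (proj inner M x) \<le> norm x * q"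
    using Q.pos_bounded by blast
  have QM: "proj inner M x \<in> M" for x
    by (rule proj_in[OF subspace_M closed_M])
  have eqI: "T y = x" if "x \<in> R" "S x = y" for x y
    using S_inv_frame_operator that by blast
  show ?thesis
  proof (rule bounded_linear_intro)
    fix x y r
    show "T (proj inner M (x + y)) = T (proj inner M x) + T (proj inner M y)"
      by (rule eqI) (auto simp: S.add Q.add frame_operator_S_inv QM
        intro!: subspace_add[OF subspace_R] S_inv_in)
    show "T (proj inner M (r *\<^sub>R x)) = r *\<^sub>R T (proj inner M x)"
      by (rule eqI) (auto simp: S.scaleR Q.scaleR frame_operator_S_inv QM
        intro!: subspace_scale[OF subspace_R] S_inv_in)
    have "c * norm (T (proj inner M x)) \<le> norm (proj inner M x)"
      using c(2)[OF S_inv_in[OF QM]] by (simp add: frame_operator_S_inv QM)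
    also have "\<dots> \<le> norm x * q" by (rule q)
    finally show "norm (T (proj inner M x)) \<le> norm x * (q / c)"
      using c(1) by (simp add: field_simps)
  qed
qed

lemma inner_S_inv_adj: "inner (S_inv_adj inner K I W \<omega> f) x = inner f (T (proj inner M x))"
  unfolding S_inv_adj_def adjoint_on_subspace[OF subspace_M closed_M bounded_linear_S_inv_proj]
  using adjoint_on_UNIV[OF bounded_linear_S_inv_proj] by (metis inner_commute)

lemma inner_L: "inner (L f) x = inner f (G x)"
  by (simp add: inner_S_inv_adj adjoint_on_UNIV[OF bounded_linear_K])

lemma bounded_linear_L: "bounded_linear (\<lambda>f. L f)"
  using adjoint_pair_bounded_linear inner_L .

text \<open>
  For \<open>y\<close> in the range of \<open>K\<close>, symmetry of \<open>S\<close> moves it to \<open>y\<close>, and the adjoint relation of \<open>T\<close> then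
  produces \<open>T (S y) = y\<close>. Expanded as a series this is the reconstruction formula of the canonical
  dual.
\<close>

lemma proj_frame_operator_L: "proj inner R (S (L f)) = K f"
proof (rule proj_eqI[OF subspace_R])
  fix y assume y: "y \<in> R"
  hence "S y \<in> M" by (simp add: SRK_def)
  hence "inner (S (L f)) y = inner (K f) y"
    using y by (simp add: frame_operator_symmetric inner_S_inv_adj S_inv_frame_operator
        proj_id[OF subspace_M closed_M])
  thus "inner (S (L f) - K f) y = 0" by (simp add: inner_diff_left)
qed simp

end

section \<open>Characterization of duals in a real Hilbert space\<close>

theorem real_dual_iff:
  fixes K :: "'a::{real_inner,complete_space} \<Rightarrow> 'a" and I :: "'i set"
  assumes "real_K_fusion_frame I W \<omega> B K A"
    and "real_bessel_fusion_sequence I V \<omega> B'"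
    and minimal: "\<And>i. i \<in> I \<Longrightarrow> W i \<inter> closure (span (\<Union>j\<in>I - {i}. W j)) = {0}"
    and transversal: "closure (span (\<Union>i\<in>I. W i)) \<inter> orth_compl inner (range K) = {0}"
  shows "(\<forall>f. ((\<lambda>i. (\<omega> i * \<omega> i) *\<^sub>R
             proj inner (range K) (proj inner (W i) (S_inv_adj inner K I W \<omega> (K (proj inner (V i) f)))))
           has_sum K f) I) \<longleftrightarrow>
    (\<forall>i\<in>I. canonical_dual_space inner K I W \<omega> i \<subseteq> V i)" (is "?dual \<longleftrightarrow> ?incl")
proof -
  interpret W: real_K_fusion_frame I W \<omega> B K A by fact
  interpret V: real_bessel_fusion_sequence I V \<omega> B' by fact
  let ?R = "range K" and ?L = W.L and ?G = W.G
  let ?d = "\<lambda>i f. f - V.P i f"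
  note R = W.subspace_R W.closed_range
  interpret L: bounded_linear ?L by (rule W.bounded_linear_L)
  interpret PR: bounded_linear "proj inner ?R" by (rule bounded_linear_proj[OF R])
  have PW: "bounded_linear (W.P i)" if "i \<in> I" for i
    using W.subspace[OF that] W.closed[OF that] by (rule bounded_linear_proj)
  have canonical: "canonical_dual_space inner K I W \<omega> i = ?G ` W i" for i
    by (simp add: canonical_dual_space_def)
  have reconstruct: "((\<lambda>i. (\<omega> i * \<omega> i) *\<^sub>R proj inner ?R (W.P i (?L f))) has_sum K f) I" for f
    using has_sum_bounded_linear[OF PR.bounded_linear_axioms W.frame_operator_has_sum[of "?L f"]]
    by (simp add: PR.scaleR W.proj_frame_operator_L power2_eq_square)
  show ?thesis
  proof
    assume incl: ?incl
    have "proj inner ?R (W.P i (?L (V.P i f))) = proj inner ?R (W.P i (?L f))" if i: "i \<in> I" for i f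
    proof -
      note Wi = W.subspace[OF i] W.closed[OF i] and Vi = V.subspace[OF i] V.closed[OF i]
      interpret P: bounded_linear "W.P i" by (rule PW[OF i])
      have "inner (proj inner ?R (W.P i (?L (?d i f)))) g = 0" for g
      proof -
        have "?G (W.P i (proj inner ?R g)) \<in> V i"
          using incl i proj_in[OF Wi] unfolding canonical by blast
        thus ?thesis
          by (simp add: inner_proj_commute[OF R] inner_proj_commute[OF Wi] W.inner_L
              proj_orthogonal[OF Vi])
      qed
      hence "proj inner ?R (W.P i (?L (?d i f))) = 0"
        by (metis inner_eq_zero_iff)
      thus ?thesis by (simp add: L.diff P.diff PR.diff)
    qed
    thus ?dual
      using reconstruct by (simp cong: has_sum_cong)
  next
    assume dual: ?dual
    have vanish: "W.P i (?L (?d i f)) = 0" if i: "i \<in> I" for i f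
    proof -
      \<comment> \<open>The summands before projection to the range of \<open>K\<close>, after which they sum to zero.\<close>
      define u where "u = (\<lambda>i. (\<omega> i * \<omega> i) *\<^sub>R W.P i (?L (?d i f)))"
      have u_eq: "u i = (\<omega> i)\<^sup>2 *\<^sub>R W.P i (?L f) + - (\<omega> i *\<^sub>R W.P i (\<omega> i *\<^sub>R ?L (V.P i f)))"
        if "i \<in> I" for i
      proof -
        interpret P: bounded_linear "W.P i" by (rule PW[OF that])
        show ?thesis
          by (simp add: u_def L.diff P.diff P.scaleR power2_eq_square scaleR_diff_right)
      qed
      have "(\<lambda>i. (norm (\<omega> i *\<^sub>R ?L (V.P i f)))\<^sup>2) summable_on I"
      proof -
        obtain C where C: "\<And>x. norm (?L x) \<le> norm x * C"
          using L.bounded by blast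
        show ?thesis
        proof (rule summable_on_comparison_test)
          show "(\<lambda>i. (\<omega> i)\<^sup>2 * (norm (V.P i f))\<^sup>2 * C\<^sup>2) summable_on I"
            using V.summable by (rule summable_on_cmult_left)
          fix i
          have "(norm (?L (V.P i f)))\<^sup>2 \<le> (norm (V.P i f) * C)\<^sup>2"
            using C by (intro power_mono) auto
          hence "(\<omega> i)\<^sup>2 * (norm (?L (V.P i f)))\<^sup>2 \<le> (\<omega> i)\<^sup>2 * (norm (V.P i f) * C)\<^sup>2"
            by (intro mult_left_mono) auto
          thus "(norm (\<omega> i *\<^sub>R ?L (V.P i f)))\<^sup>2 \<le> (\<omega> i)\<^sup>2 * (norm (V.P i f))\<^sup>2 * C\<^sup>2"
            by (simp add: power_mult_distrib mult_ac)
        qed auto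
      qed
      hence "(\<lambda>i. \<omega> i *\<^sub>R W.P i (\<omega> i *\<^sub>R ?L (V.P i f))) summable_on I"
        by (rule W.synthesis_summable)
      moreover have "(\<lambda>i. (\<omega> i)\<^sup>2 *\<^sub>R W.P i (?L f)) summable_on I"
        using W.frame_operator_has_sum summable_on_def by blast
      ultimately have "(\<lambda>i. (\<omega> i)\<^sup>2 *\<^sub>R W.P i (?L f)
          + - (\<omega> i *\<^sub>R W.P i (\<omega> i *\<^sub>R ?L (V.P i f)))) summable_on I"
        by (intro summable_on_add) (simp_all add: summable_on_uminus)
      hence "u summable_on I"
        using u_eq by (simp cong: summable_on_cong)
      then obtain s where s: "(u has_sum s) I"
        by (auto simp: summable_on_def)
      have u_W: "u i \<in> W i" if "i \<in> I" for i
        using W.subspace[OF that] W.closed[OF that] by (simp add: u_def subspace_scale proj_in)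
      have "((\<lambda>i. (\<omega> i * \<omega> i) *\<^sub>R proj inner ?R (W.P i (?L f))
          + - ((\<omega> i * \<omega> i) *\<^sub>R proj inner ?R (W.P i (?L (V.P i f))))) has_sum 0) I"
      proof -
        have "((\<lambda>i. - ((\<omega> i * \<omega> i) *\<^sub>R proj inner ?R (W.P i (?L (V.P i f))))) has_sum - K f) I"
          using dual by (simp add: has_sum_uminus)
        from has_sum_add[OF reconstruct[of f] this] show ?thesis by simp
      qed
      moreover have "proj inner ?R (u i) = (\<omega> i * \<omega> i) *\<^sub>R proj inner ?R (W.P i (?L f))
          + - ((\<omega> i * \<omega> i) *\<^sub>R proj inner ?R (W.P i (?L (V.P i f))))" if "i \<in> I" for i
      proof -
        interpret P: bounded_linear "W.P i" by (rule PW[OF that])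
        show ?thesis
          by (simp add: u_def L.diff P.diff PR.diff PR.scaleR scaleR_diff_right)
      qed
      ultimately have "((\<lambda>i. proj inner ?R (u i)) has_sum 0) I"
        by (simp cong: has_sum_cong)
      hence "proj inner ?R s = 0"
        using has_sum_bounded_linear[OF PR.bounded_linear_axioms s] has_sum_unique by blast
      hence "s \<in> orth_compl inner ?R"
        using proj_orthogonal[OF R, of _ s] by (simp add: orth_compl_def)
      moreover have "s \<in> closure (span (\<Union>i\<in>I. W i))"
        using u_W by (intro has_sum_in_closure_span[OF s]) blast
      ultimately have "s = 0"
        using transversal by blast
      \<comment> \<open>\<open>u i\<close> is minus the sum of the others, hence lies in their closed span.\<close>
      have "(u has_sum - u i) (I - {i})"
        using has_sum_Diff[OF s has_sum_finite[of "{i}" u]] i \<open>s = 0\<close> by simp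
      hence "((\<lambda>j. - u j) has_sum u i) (I - {i})"
        by (simp add: has_sum_uminus)
      hence "u i \<in> closure (span (\<Union>j\<in>I - {i}. W j))"
        by (rule has_sum_in_closure_span) (auto intro!: subspace_neg W.subspace u_W)
      hence "u i = 0"
        using minimal[OF i] u_W[OF i] by auto
      thus ?thesis
        using W.weight_pos[OF i] by (simp add: u_def)
    qed
    show ?incl
    proof (intro ballI subsetI)
      fix i z assume i: "i \<in> I" and "z \<in> canonical_dual_space inner K I W \<omega> i"
      then obtain x where x: "x \<in> W i" "z = ?G x"
        unfolding canonical by blast
      note Wi = W.subspace[OF i] W.closed[OF i] and Vi = V.subspace[OF i] V.closed[OF i]
      show "z \<in> V i"
      proof (rule mem_if_orthogonal_to_orthogonal[OF Vi])
        fix y assume "\<And>v. v \<in> V i \<Longrightarrow> inner y v = 0"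
        hence "V.P i y = 0" by (rule proj_eq_0[OF Vi])
        hence "W.P i (?L y) = 0" using vanish[OF i, of y] by simp
        hence "inner (?L y) x = 0"
          using inner_proj_left[OF Wi x(1), of "?L y"] by simp
        thus "inner y z = 0" by (simp add: x(2) W.inner_L)
      qed
    qed
  qed
qed

section \<open>Passing to the real part of the inner product\<close>

context hilbert_space
begin

lemma ip_zero_left: "ip 0 z = 0"
  using ip_add_left[of 0 0 z] by simp

lemma ip_add_right: "ip x (y + z) = ip x y + ip x z"
  by (subst (1 2 3) ip_commute) (simp add: ip_add_left conjugate_dist_add)

text \<open>
  Polarization: both inner products induce the same norm, so \<open>inner\<close> is the real part of \<open>ip\<close>.
\<close>

lemma of_real_twice_inner: "of_real (2 * inner x y) = ip x y + conjugate (ip x y)"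
proof -
  have "of_real ((norm (x + y))\<^sup>2) = of_real ((norm x)\<^sup>2) + of_real ((norm y)\<^sup>2) + (ip x y + ip y x)"
    unfolding ip_self[symmetric] by (simp add: ip_add_left ip_add_right)
  moreover have "(norm (x + y))\<^sup>2 = (norm x)\<^sup>2 + (norm y)\<^sup>2 + 2 * inner x y"
    by (simp add: power2_norm_eq_inner inner_simps inner_commute)
  ultimately show ?thesis
    by (simp add: ip_commute[of y x])
qed

lemma inner_eqI: "ip x y = ip z w \<Longrightarrow> inner x y = inner z w"
  by (metis of_real_twice_inner of_real_eq_iff mult_left_cancel zero_neq_numeral)

text \<open>
  The real part of \<open>c * d\<close> vanishes for every scalar \<open>c\<close>, and taking \<open>c\<close> to be the conjugate of \<open>d\<close>
  shows \<open>d = 0\<close>. So an identity of real inner products that holds on a subspace over the scalar field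
  lifts to \<open>ip\<close>.
\<close>

lemma ip_eqI:
  assumes "\<And>c. inner (smul c x) y = inner (smul c z) w"
  shows "ip x y = ip z w"
proof -
  define d where "d = ip x y - ip z w"
  have "c * d + conjugate (c * d) = 0" for c
  proof -
    have "c * ip x y + conjugate (c * ip x y) = c * ip z w + conjugate (c * ip z w)"
      using assms[of c] of_real_twice_inner[of "smul c x" y] of_real_twice_inner[of "smul c z" w]
      by (simp add: ip_smul_left)
    moreover have "c * ip x y = c * d + c * ip z w" by (simp add: d_def algebra_simps)
    ultimately show ?thesis by (simp add: conjugate_dist_add)
  qed
  from this[of "conjugate d"] have "2 * (d * conjugate d) = 0"
    by (simp add: conjugate_dist_mul mult.commute)
  hence "d = 0" by simp
  thus ?thesis by (simp add: d_def)
qed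

lemma norm_smul: "norm (smul c x) = norm c * norm x"
proof -
  have "of_real ((norm (smul c x))\<^sup>2) = c * conjugate (c * ip x x)"
    unfolding ip_self[symmetric] by (simp add: ip_smul_left ip_commute[of x "smul c x"])
  also have "\<dots> = (c * conjugate c) * ip x x"
    using ip_commute[of x x] by (simp add: conjugate_dist_mul)
  also have "\<dots> = of_real ((norm c * norm x)\<^sup>2)"
    by (simp add: mult_conjugate ip_self scaleR_conv_of_real power_mult_distrib)
  finally show ?thesis
    by (simp only: of_real_eq_iff power2_eq_iff_nonneg norm_ge_zero mult_nonneg_nonneg)
qed

lemma bounded_linear_smul: "bounded_linear (smul c)"
proof (rule bounded_linear_intro)
  show "smul c (r *\<^sub>R x) = r *\<^sub>R smul c x" for r x
    by (simp add: mult.commute flip: smul_of_real)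
  show "norm (smul c x) \<le> norm x * norm c" for x
    by (simp add: norm_smul)
qed (simp add: scale_right_distrib)

lemma real_subspace: "subspace V \<Longrightarrow> Real_Vector_Spaces.subspace V"
  by (rule real_vector.subspaceI)
    (auto simp: subspace_0 subspace_add subspace_scale simp flip: smul_of_real)

lemma real_span_subset: "Real_Vector_Spaces.span X \<subseteq> span X"
  by (rule real_vector.span_minimal) (auto simp: span_base real_subspace)

lemma orth_compl_eq:
  assumes "subspace V"
  shows "orth_compl ip V = orth_compl inner V"
proof -
  have "ip x y = 0 \<longleftrightarrow> ip y x = 0" for x y
    by (metis ip_commute conjugate_zero)
  moreover have "(\<forall>y\<in>V. ip y x = 0) \<longleftrightarrow> (\<forall>y\<in>V. inner y x = 0)" for x
  proof (intro iffI ballI)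
    fix y assume "\<forall>y\<in>V. ip y x = 0" "y \<in> V"
    thus "inner y x = 0" using inner_eqI[of y x 0 0] by (simp add: ip_zero_left)
  next
    fix y assume "\<forall>y\<in>V. inner y x = 0" "y \<in> V"
    thus "ip y x = 0"
      using ip_eqI[of y x 0 0] assms by (simp add: ip_zero_left subspace_scale)
  qed
  ultimately show ?thesis
    by (auto simp: orth_compl_def inner_commute)
qed

lemma proj_eq:
  assumes "subspace V"
  shows "proj ip V = proj inner V"
  unfolding proj_def orth_compl_eq[OF assms] ..

lemma proj_smul:
  assumes "subspace V" "closed V"
  shows "proj inner V (smul c f) = smul c (proj inner V f)"
proof (rule proj_eqI)
  note V = real_subspace[OF assms(1)] assms(2)
  show "Real_Vector_Spaces.subspace V" by (rule V)
  show "smul c (proj inner V f) \<in> V"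
    using proj_in[OF V] assms(1) by (simp add: subspace_scale)
  have "f - proj inner V f \<in> orth_compl ip V"
    using proj_orthogonal[OF V] unfolding orth_compl_eq[OF assms(1)] by (simp add: orth_compl_def)
  hence "smul c (f - proj inner V f) \<in> orth_compl ip V"
    by (simp add: orth_compl_def ip_smul_left)
  thus "inner (smul c f - smul c (proj inner V f)) w = 0" if "w \<in> V" for w
    using that unfolding orth_compl_eq[OF assms(1)]
    by (simp add: orth_compl_def scale_right_diff_distrib)
qed

text \<open>
  The homogeneity of \<open>T\<close> lets the real adjoint equation be tested at all multiples of \<open>x\<close>, as \<open>ip_eqI\<close>
  requires.
\<close>

lemma adjoint_on_eq:
  assumes "subspace U" "\<And>c x. x \<in> U \<Longrightarrow> T (smul c x) = smul c (T x)"
  shows "adjoint_on ip U T = adjoint_on inner U T"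
proof -
  have "(\<forall>x\<in>U. ip (T x) y = ip x z) \<longleftrightarrow> (\<forall>x\<in>U. inner (T x) y = inner x z)" for y z
  proof (intro iffI ballI)
    fix x assume "\<forall>x\<in>U. ip (T x) y = ip x z" "x \<in> U"
    thus "inner (T x) y = inner x z" by (auto intro: inner_eqI)
  next
    fix x assume *: "\<forall>x\<in>U. inner (T x) y = inner x z" "x \<in> U"
    show "ip (T x) y = ip x z"
    proof (rule ip_eqI)
      fix c
      have "smul c x \<in> U" using * assms(1) by (simp add: subspace_scale)
      thus "inner (smul c (T x)) y = inner (smul c x) z"
        using * assms(2)[of x c] by metis
    qed
  qed
  thus ?thesis unfolding adjoint_on_def by simp
qed

lemma bessel_fusion_sequence_imp_real:
  assumes "bessel_fusion_sequence smul ip I W \<omega>"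
  shows "\<exists>B. real_bessel_fusion_sequence I W \<omega> B"
proof -
  have W: "subspace (W i)" "closed (W i)" "\<omega> i > 0" if "i \<in> I" for i
    using assms that by (auto simp: bessel_fusion_sequence_def closed_subspace_def)
  have eq: "(\<omega> i)\<^sup>2 * (norm (proj ip (W i) f))\<^sup>2 = (\<omega> i)\<^sup>2 * (norm (proj inner (W i) f))\<^sup>2"
    if "i \<in> I" for i f
    using W(1)[OF that] by (simp add: proj_eq)
  obtain B where B: "(\<lambda>i. (\<omega> i)\<^sup>2 * (norm (proj ip (W i) f))\<^sup>2) summable_on I"
      "(\<Sum>\<^sub>\<infinity>i\<in>I. (\<omega> i)\<^sup>2 * (norm (proj ip (W i) f))\<^sup>2) \<le> B * (norm f)\<^sup>2" for f
    using assms unfolding bessel_fusion_sequence_def by blast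
  \<comment> \<open>In the zero space a negative bound is possible; hence the maximum.\<close>
  have "real_bessel_fusion_sequence I W \<omega> (max B 0)"
  proof
    fix f
    show "(\<lambda>i. (\<omega> i)\<^sup>2 * (norm (proj inner (W i) f))\<^sup>2) summable_on I"
      using B(1)[of f] by (subst summable_on_cong[OF eq[symmetric]])
    have "(\<Sum>\<^sub>\<infinity>i\<in>I. (\<omega> i)\<^sup>2 * (norm (proj inner (W i) f))\<^sup>2) \<le> B * (norm f)\<^sup>2"
      using B(2)[of f] by (subst infsum_cong[OF eq[symmetric]])
    also have "\<dots> \<le> max B 0 * (norm f)\<^sup>2"
      by (rule mult_right_mono) auto
    finally show "(\<Sum>\<^sub>\<infinity>i\<in>I. (\<omega> i)\<^sup>2 * (norm (proj inner (W i) f))\<^sup>2) \<le> max B 0 * (norm f)\<^sup>2" .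
  qed (use W real_subspace in auto)
  thus ?thesis by blast
qed

end

section \<open>Characterization of duals of a minimal K-fusion frame\<close>

theorem theorem3p13:
  fixes smul :: "'k::rc_field \<Rightarrow> 'a::{real_inner,complete_space} \<Rightarrow> 'a"
    and ip :: "'a \<Rightarrow> 'a \<Rightarrow> 'k"
    and K :: "'a \<Rightarrow> 'a"
    and I :: "'i set"
    and W V :: "'i \<Rightarrow> 'a set"
    and \<omega> :: "'i \<Rightarrow> real"
  assumes "hilbert_space smul ip"
    and "separable_space (euclidean :: 'a topology)"
    and "countable I"
    and "bounded_operator smul K"
    and "closed (range K)"
    and "K_fusion_frame smul ip K I W \<omega>"
    and "minimal_family smul I W"
    and "bessel_fusion_sequence smul ip I (canonical_dual_space ip K I W \<omega>) \<omega>"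
    and "closed_span smul (\<Union>i\<in>I. W i) \<inter> orth_compl ip (range K) = {0}"
    and "bessel_fusion_sequence smul ip I V \<omega>"
  shows "K_dual smul ip K I W \<omega> V \<omega> \<longleftrightarrow>
    (\<forall>i\<in>I. canonical_dual_space ip K I W \<omega> i \<subseteq> V i)"
proof -
  interpret H: hilbert_space smul ip by fact
  interpret K: Vector_Spaces.linear smul smul K
    using assms(4) by (simp add: bounded_operator_def)
  have besselW: "bessel_fusion_sequence smul ip I W \<omega>"
    using assms(6) by (simp add: K_fusion_frame_def)
  have W: "H.subspace (W i)" "closed (W i)" if "i \<in> I" for i
    using besselW that by (auto simp: bessel_fusion_sequence_def closed_subspace_def)
  have V: "H.subspace (V i)" "closed (V i)" if "i \<in> I" for i
    using assms(10) that by (auto simp: bessel_fusion_sequence_def closed_subspace_def)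
  have R: "H.subspace (range K)"
    using K.subspace_image[OF H.subspace_UNIV] .
  have K: "bounded_linear K"
  proof -
    obtain C where "\<And>x. norm (K x) \<le> C * norm x"
      using assms(4) by (auto simp: bounded_operator_def)
    moreover have "K (r *\<^sub>R x) = r *\<^sub>R K x" for r x
      by (simp add: K.scale flip: H.smul_of_real)
    ultimately show ?thesis
      by (intro bounded_linear_intro[of K C]) (simp_all add: K.add mult.commute)
  qed
  have Kadj: "adjoint_on ip UNIV K = adjoint_on inner UNIV K"
    by (rule H.adjoint_on_eq) (simp_all add: H.subspace_UNIV K.scale)
  obtain A where A: "A > 0" "\<And>f. A * (norm (adjoint_on ip UNIV K f))\<^sup>2
       \<le> (\<Sum>\<^sub>\<infinity>i\<in>I. (\<omega> i)\<^sup>2 * (norm (proj ip (W i) f))\<^sup>2)"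
    using assms(6) by (auto simp: K_fusion_frame_def)
  obtain B where "real_bessel_fusion_sequence I W \<omega> B"
    using H.bessel_fusion_sequence_imp_real[OF besselW] by blast
  then interpret F: real_bessel_fusion_sequence I W \<omega> B .
  interpret F: real_K_fusion_frame I W \<omega> B K A
  proof (intro real_K_fusion_frame.intro real_K_fusion_frame_axioms.intro)
    fix f
    have "A * (norm (adjoint_on inner UNIV K f))\<^sup>2
       \<le> (\<Sum>\<^sub>\<infinity>i\<in>I. (\<omega> i)\<^sup>2 * (norm (proj ip (W i) f))\<^sup>2)"
      using A(2)[of f] by (simp add: Kadj)
    also have "\<dots> = (\<Sum>\<^sub>\<infinity>i\<in>I. (\<omega> i)\<^sup>2 * (norm (proj inner (W i) f))\<^sup>2)"
      by (rule infsum_cong) (simp add: H.proj_eq W)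
    finally show "A * (norm (adjoint_on inner UNIV K f))\<^sup>2
       \<le> (\<Sum>\<^sub>\<infinity>i\<in>I. (\<omega> i)\<^sup>2 * (norm (proj inner (W i) f))\<^sup>2)" .
  qed (fact F.real_bessel_fusion_sequence_axioms K assms(5) A(1))+
  obtain B' where F': "real_bessel_fusion_sequence I V \<omega> B'"
    using H.bessel_fusion_sequence_imp_real[OF assms(10)] by blast

  let ?S = "frame_operator inner I W \<omega>" and ?M = "SRK inner K I W \<omega>" and ?T = "S_inv inner K I W \<omega>"
  have S: "frame_operator ip I W \<omega> = ?S"
    unfolding frame_operator_def by (intro ext infsum_cong) (simp add: H.proj_eq W)
  \<comment> \<open>Homogeneity of \<open>S\<close>, hence of its inverse, is what identifies the two adjoints of the inverse.\<close>
  have S_smul: "?S (smul c f) = smul c (?S f)" for c f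
  proof -
    interpret smul: bounded_linear "smul c" by (rule H.bounded_linear_smul)
    have eq: "(\<omega> i)\<^sup>2 *\<^sub>R F.P i (smul c f) = smul c ((\<omega> i)\<^sup>2 *\<^sub>R F.P i f)" if "i \<in> I" for i
      using that by (simp add: smul.scaleR H.proj_smul W)
    have "((\<lambda>i. (\<omega> i)\<^sup>2 *\<^sub>R F.P i (smul c f)) has_sum smul c (?S f)) I"
      using has_sum_bounded_linear[OF smul.bounded_linear_axioms F.frame_operator_has_sum[of f]]
      by (subst has_sum_cong[OF eq])
    thus ?thesis
      by (rule has_sum_unique[OF F.frame_operator_has_sum])
  qed
  have M: "H.subspace ?M"
  proof (rule H.subspaceI)
    note M = F.subspace_M
    show "0 \<in> ?M" "\<And>x y. x \<in> ?M \<Longrightarrow> y \<in> ?M \<Longrightarrow> x + y \<in> ?M"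
      using M by (auto intro: subspace_0 subspace_add)
    show "smul c x \<in> ?M" if "x \<in> ?M" for c x
      using that unfolding SRK_def
      by (auto simp flip: S_smul K.scale)
  qed
  have T_smul: "?T (smul c y) = smul c (?T y)" if "y \<in> ?M" for c y
    using F.S_inv_frame_operator[of "smul c (?T y)"] H.subspace_scale[OF R F.S_inv_in[OF that]] that
    by (simp add: S_smul F.frame_operator_S_inv)
  have M_eq: "SRK ip K I W \<omega> = ?M" and T_eq: "S_inv ip K I W \<omega> = ?T"
    by (simp_all add: SRK_def S_inv_def S)
  have T_adj: "S_inv_adj ip K I W \<omega> = S_inv_adj inner K I W \<omega>"
    unfolding S_inv_adj_def M_eq T_eq using M T_smul by (rule H.adjoint_on_eq)
  have canonical: "canonical_dual_space ip K I W \<omega> = canonical_dual_space inner K I W \<omega>"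
    by (simp add: canonical_dual_space_def fun_eq_iff M_eq T_eq Kadj H.proj_eq M)
  have dual: "K_dual smul ip K I W \<omega> V \<omega> \<longleftrightarrow> (\<forall>f. ((\<lambda>i. (\<omega> i * \<omega> i) *\<^sub>R
       proj inner (range K) (proj inner (W i) (S_inv_adj inner K I W \<omega> (K (proj inner (V i) f)))))
       has_sum K f) I)"
  proof -
    have eq: "proj ip (range K) (proj ip (W i) (S_inv_adj ip K I W \<omega> (K (proj ip (V i) f)))) =
        proj inner (range K) (proj inner (W i) (S_inv_adj inner K I W \<omega> (K (proj inner (V i) f))))"
      if "i \<in> I" for i f
      using that by (simp add: H.proj_eq R W V T_adj)
    show ?thesis
      unfolding K_dual_def using assms(10) eq by (simp cong: has_sum_cong)
  qed
  \<comment> \<open>Real spans are the smaller ones, so the disjointness hypotheses hold for them too.\<close>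
  have closure_span: "closure (span X) \<subseteq> closed_span smul X" for X
    unfolding closed_span_def by (rule closure_mono) (rule H.real_span_subset)
  have zero: "0 \<in> closure (span X)" for X :: "'a set"
    using closure_subset span_zero by blast
  show ?thesis
    unfolding dual canonical
  proof (rule real_dual_iff[OF F.real_K_fusion_frame_axioms F'])
    fix i assume i: "i \<in> I"
    have "W i \<inter> closed_span smul (\<Union>j\<in>I - {i}. W j) = {0}"
      using assms(7) i by (simp add: minimal_family_def)
    thus "W i \<inter> closure (span (\<Union>j\<in>I - {i}. W j)) = {0}"
      using closure_span[of "\<Union>j\<in>I - {i}. W j"] zero[of "\<Union>j\<in>I - {i}. W j"] by blast
  next
    show "closure (span (\<Union>i\<in>I. W i)) \<inter> orth_compl inner (range K) = {0}"
      using assms(9) closure_span[of "\<Union>i\<in>I. W i"] zero[of "\<Union>i\<in>I. W i"]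
      unfolding H.orth_compl_eq[OF R] by blast
  qed
qed

end
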